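(* For $n\geq 1$ let $a_{2n-1}=(-1)^{n-1}$ and $a_{2n}=0$. Then for every $n\geq 1$ the Euler number $E_{n+1}$ equals the lower Hessenberg determinant of order $n$ $$E_{n+1}=\det(m_{i,j})_{1\leq i,j\leq n},$$ where $m_{i,j}=\binom{i}{j-1}a_{i-j+1}$ for $1\leq j\leq i\leq n$, $m_{i,i+1}=-1$ for $1\leq i\leq n-1$, and $m_{i,j}=0$ for $j>i+1$. Moreover, for $n\geq 1$ the Euler numbers satisfy $$E_{n+1}=\sum_{r=1}^n\binom{n}{r-1}a_{n-r+1}E_r,$$ with initial values $E_1=E_2=1$ and $E_3=2$.
   Context: The Euler number $E_n$ is the number of alternating permutations in the symmetric group $\mathfrak{S}_n$, i.e. permutations $\pi$ with $\pi(1)>\pi(2)<\pi(3)>\cdots$ ($\pi(2i-1)>\pi(2i)$ and $\pi(2i)<\pi(2i+1)$ for all $i$ for which these make sense). Equivalently, $\sum_{n\geq 0}E_n z^n/n!=\tan z+\sec z$. *)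

theory Defs
  imports "Jordan_Normal_Form.Determinant"
begin

definition alternating :: "nat \<Rightarrow> (nat \<Rightarrow> nat) \<Rightarrow> bool" where
  "alternating n p \<longleftrightarrow>
     (\<forall>i\<ge>1. 2 * i \<le> n \<longrightarrow> p (2 * i - 1) > p (2 * i)) \<and>
     (\<forall>i\<ge>1. 2 * i + 1 \<le> n \<longrightarrow> p (2 * i) < p (2 * i + 1))"

definition euler_number :: "nat \<Rightarrow> nat" where
  "euler_number n = card {p. p permutes {1..n} \<and> alternating n p}"

text \<open>Rows and columns are numbered from 1 here; library matrices are numbered from 0,
  hence the shift in the second definition.\<close>

definition hessenberg_entry :: "(nat \<Rightarrow> int) \<Rightarrow> nat \<Rightarrow> nat \<Rightarrow> int" where
  "hessenberg_entry a i j =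
     (if j \<le> i then int (i choose (j - 1)) * a (i - j + 1)
      else if j = i + 1 then - 1
      else 0)"

definition hessenberg_mat :: "(nat \<Rightarrow> int) \<Rightarrow> nat \<Rightarrow> int mat" where
  "hessenberg_mat a n = mat n n (\<lambda>(i, j). hessenberg_entry a (i + 1) (j + 1))"

end

theory Submission
  imports Defs "HOL-Combinatorics.Multiset_Permutations"
begin

text \<open>
  The recurrence carries the combinatorial content; the determinant is a consequence of it by
  linear algebra.

  For the recurrence, consider words that use each of the letters \<open>1, \<dots>, n + 1\<close> once and are
  glued from a strictly decreasing prefix of length \<open>k\<close> that avoids the largest letter and a rest
  that zigzags, starting with a descent. The set of letters of the prefix determines the prefix, so
  there are \<open>(n choose k) * E (n + 1 - k)\<close> such words (\<open>card_free_words\<close>). Now look at the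
  junction of prefix and rest. Either the word ascends there, or it descends; in the latter
  case the first two letters of the rest prolong the decreasing prefix to length \<open>k + 2\<close>, and the
  word ascends right after that longer prefix. So if \<open>g k\<close> counts the words that ascend at the
  junction, the number of glued words is \<open>g k + g (k + 2)\<close> (\<open>card_free_words_split\<close>).
  The coefficients \<open>a 1, a 2, \<dots>\<close> are \<open>1, 0, -1, 0, 1, \<dots>\<close>, so \<open>a (k + 2) = - a k\<close> and the weighted sum
  of these counts telescopes to \<open>g 1\<close>, because a decreasing prefix without the largest letter
  cannot be the whole word. The words counted by \<open>g 1\<close> zigzag from an initial ascent, and
  complementing letters turns them into alternating permutations of \<open>n + 1\<close> letters.

  For the determinant, the recurrences for \<open>E 2, \<dots>, E (n + 1)\<close> say that the Hessenberg matrix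
  maps the vector \<open>(E 1, \<dots>, E n)\<close> to \<open>(0, \<dots>, 0, E (n + 1))\<close>. As \<open>E 1 = 1\<close>, replacing the
  first column of the matrix by this image keeps the determinant. Laplace expansion
  along the new column leaves a triangular minor with \<open>-1\<close> on its diagonal
  (\<open>det_hessenberg_mat\<close>).
\<close>

section \<open>Alternating words\<close>

text \<open>The flag tells whether the word must begin with a descent. Recursion on words makes gluing
  and cutting of words a matter of simplification.\<close>
fun zigzag :: "bool \<Rightarrow> 'a::linorder list \<Rightarrow> bool" where
  "zigzag d (x # y # xs) \<longleftrightarrow> (if d then x > y else x < y) \<and> zigzag (\<not> d) (y # xs)"
| "zigzag d xs \<longleftrightarrow> True"

lemma zigzag_conv_nth:
  "zigzag d xs \<longleftrightarrow>
     (\<forall>i. Suc i < length xs \<longrightarrow> (if even i = d then xs ! i > xs ! Suc i else xs ! i < xs ! Suc i))"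
proof (induction d xs rule: zigzag.induct)
  case (1 d x y xs)
  have all_nat: "(\<forall>i. Q i) \<longleftrightarrow> Q 0 \<and> (\<forall>i. Q (Suc i))" for Q :: "nat \<Rightarrow> bool"
    by (metis nat.exhaust)
  show ?case
    unfolding zigzag.simps "1.IH" by (subst (2) all_nat) (cases d; simp)
qed auto

lemma zigzag_map_strict_mono:
  assumes "strict_mono_on (set xs) h"
  shows "zigzag d (map h xs) \<longleftrightarrow> zigzag d xs"
proof -
  have "h (xs ! i) < h (xs ! j) \<longleftrightarrow> xs ! i < xs ! j" if "i < length xs" "j < length xs" for i j
    using assms that by (simp add: strict_mono_on_less)
  then show ?thesis
    unfolding zigzag_conv_nth by auto
qed

lemma zigzag_map_complement:
  fixes c :: nat
  assumes "\<forall>x\<in>set xs. x \<le> c"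
  shows "zigzag d (map (\<lambda>x. c - x) xs) \<longleftrightarrow> zigzag (\<not> d) xs"
  using assms by (induction d xs rule: zigzag.induct) auto

text \<open>Relabelling letters is a bijection between arrangements. It is used with order-preserving
  maps, to see that only the number of letters matters, and with the order-reversing
  complement.\<close>
lemma card_permutations_of_set_transfer:
  assumes h: "bij_betw h A B"
    and P: "\<And>xs. xs \<in> permutations_of_set A \<Longrightarrow> P xs \<longleftrightarrow> Q (map h xs)"
  shows "card {xs \<in> permutations_of_set A. P xs} = card {ys \<in> permutations_of_set B. Q ys}"
proof (rule bij_betw_same_card)
  let ?g = "inv_into A h"
  have g: "bij_betw ?g B A"
    using h by (rule bij_betw_inv_into)
  have gh: "map ?g (map h xs) = xs" if "xs \<in> permutations_of_set A" for xs
    using that h by (auto simp: permutations_of_set_def bij_betw_def intro!: map_idI)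
  have hg: "map h (map ?g ys) = ys" if "ys \<in> permutations_of_set B" for ys
    using that h by (auto simp: permutations_of_set_def bij_betw_inv_into_right intro!: map_idI)
  show "bij_betw (map h) {xs \<in> permutations_of_set A. P xs} {ys \<in> permutations_of_set B. Q ys}"
  proof (rule bij_betw_byWitness[where f' = "map ?g"])
    show "map ?g ` {ys \<in> permutations_of_set B. Q ys} \<subseteq> {xs \<in> permutations_of_set A. P xs}"
    proof safe
      fix ys assume ys: "ys \<in> permutations_of_set B" "Q ys"
      have "map ?g ys \<in> permutations_of_set A"
        using ys(1) g by (auto simp: permutations_of_set_def bij_betw_def distinct_map)
      then show "map ?g ys \<in> permutations_of_set A" "P (map ?g ys)"
        using P ys hg by auto
    qed
    show "map h ` {xs \<in> permutations_of_set A. P xs} \<subseteq> {ys \<in> permutations_of_set B. Q ys}"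
      using P h by (auto simp: permutations_of_set_def bij_betw_def distinct_map)
  qed (use gh hg in auto)
qed

lemma alternating_iff_zigzag: "alternating n p \<longleftrightarrow> zigzag True (map p [1..<Suc n])"
proof
  assume alt: "alternating n p"
  show "zigzag True (map p [1..<Suc n])"
    unfolding zigzag_conv_nth
  proof (intro allI impI)
    fix i assume "Suc i < length (map p [1..<Suc n])"
    then have i: "Suc (Suc i) \<le> n" by (simp del: upt_Suc)
    have desc: "p (2 * j) < p (2 * j - 1)" if "1 \<le> j" "2 * j \<le> n" for j
      using alt that by (simp add: alternating_def)
    have asc: "p (2 * j) < p (2 * j + 1)" if "1 \<le> j" "2 * j + 1 \<le> n" for j
      using alt that by (simp add: alternating_def)
    have "if even i then p (Suc (Suc i)) < p (Suc i) else p (Suc i) < p (Suc (Suc i))"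
    proof (cases "even i")
      case True
      then obtain k where "i = 2 * k" by blast
      then show ?thesis using desc[of "Suc k"] i by simp
    next
      case False
      then obtain k where "i = 2 * k + 1" by (rule oddE)
      then show ?thesis using asc[of "Suc k"] i by simp
    qed
    then show "if even i = True then map p [1..<Suc n] ! i > map p [1..<Suc n] ! Suc i
      else map p [1..<Suc n] ! i < map p [1..<Suc n] ! Suc i"
      using i by (simp del: upt_Suc)
  qed
next
  assume "zigzag True (map p [1..<Suc n])"
  then have step: "if even i then p (Suc i) > p (Suc (Suc i)) else p (Suc i) < p (Suc (Suc i))"
    if "Suc i < n" for i
    using that unfolding zigzag_conv_nth by (auto simp del: upt_Suc)
  show "alternating n p"
    unfolding alternating_def
  proof (intro conjI allI impI)
    fix i :: nat assume "1 \<le> i"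
    then obtain j where i: "i = Suc j"
      by (metis Suc_le_D One_nat_def)
    show "p (2 * i) < p (2 * i - 1)" if "2 * i \<le> n"
      using step[of "2 * j"] that by (simp add: i)
    show "p (2 * i) < p (2 * i + 1)" if "2 * i + 1 \<le> n"
      using step[of "2 * j + 1"] that by (simp add: i)
  qed
qed

text \<open>A permutation is identified with its one-line notation; in the inverse direction, the
  function has to be extended by the identity outside \<open>{1..n}\<close>.\<close>
lemma euler_number_eq_card_words:
  "euler_number n = card {xs \<in> permutations_of_set {1..n}. zigzag True xs}"
  unfolding euler_number_def
proof (rule bij_betw_same_card)
  let ?L = "\<lambda>p. map p [1..<Suc n]"
  let ?p = "\<lambda>xs i. if i \<in> {1..n} then xs ! (i - 1) else i"
  have L_p: "?L (?p xs) = xs" if "xs \<in> permutations_of_set {1..n}" for xs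
  proof -
    have "length xs = n"
      using that distinct_card[of xs] by (auto simp: permutations_of_set_def)
    then show ?thesis
      by (intro nth_equalityI) (auto simp del: upt_Suc)
  qed
  have p_permutes: "?p xs permutes {1..n}" if "xs \<in> permutations_of_set {1..n}" for xs
  proof (rule bij_imp_permutes)
    have "distinct (?L (?p xs))" "set (?L (?p xs)) = {1..n}"
      using that unfolding L_p[OF that] by (auto simp: permutations_of_set_def)
    then show "bij_betw (?p xs) {1..n} {1..n}"
      unfolding distinct_map set_map set_upt atLeastLessThanSuc_atLeastAtMost bij_betw_def by blast
  qed auto
  show "bij_betw ?L {p. p permutes {1..n} \<and> alternating n p}
          {xs \<in> permutations_of_set {1..n}. zigzag True xs}"
  proof (rule bij_betw_byWitness[where f' = ?p])
    show "\<forall>p\<in>{p. p permutes {1..n} \<and> alternating n p}. ?p (?L p) = p"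
    proof (intro ballI ext)
      fix p i assume "p \<in> {p. p permutes {1..n} \<and> alternating n p}"
      then show "?p (?L p) i = p i"
        by (auto simp: permutes_not_in simp del: upt_Suc)
    qed
    show "?L ` {p. p permutes {1..n} \<and> alternating n p}
        \<subseteq> {xs \<in> permutations_of_set {1..n}. zigzag True xs}"
    proof safe
      fix p assume p: "p permutes {1..n}" "alternating n p"
      show "?L p \<in> permutations_of_set {1..n}"
        using p(1) by (auto simp: permutations_of_set_def distinct_map permutes_inj_on
            permutes_image atLeastLessThanSuc_atLeastAtMost simp del: upt_Suc)
      show "zigzag True (?L p)"
        using p(2) by (simp only: alternating_iff_zigzag)
    qed
    show "?p ` {xs \<in> permutations_of_set {1..n}. zigzag True xs}
        \<subseteq> {p. p permutes {1..n} \<and> alternating n p}"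
      using p_permutes L_p by (auto simp only: alternating_iff_zigzag)
  qed (use L_p in blast)
qed

text \<open>The order-preserving enumerations of \<open>A\<close> and of \<open>{1..card A}\<close> have the same
  domain, so both sets admit as many zigzag arrangements as that domain does.\<close>
lemma card_zigzag_words:
  fixes A :: "nat set"
  assumes "finite A"
  shows "card {xs \<in> permutations_of_set A. zigzag True xs} = euler_number (card A)"
proof -
  have transfer: "card {xs \<in> permutations_of_set {..<card B}. zigzag True xs}
      = card {xs \<in> permutations_of_set B. zigzag True xs}" if "finite B" for B :: "nat set"
  proof -
    obtain h where h: "bij_betw h {..<card B} B" "strict_mono_on {..<card B} h"
      using ex_bij_betw_strict_mono_card[OF \<open>finite B\<close>] by blast
    show ?thesis
    proof (rule card_permutations_of_set_transfer[OF h(1)])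
      fix xs assume "xs \<in> permutations_of_set {..<card B}"
      then have "set xs = {..<card B}"
        by (simp add: permutations_of_set_def)
      then show "zigzag True xs \<longleftrightarrow> zigzag True (map h xs)"
        using h(2) by (metis zigzag_map_strict_mono)
    qed
  qed
  show ?thesis
    using transfer[OF assms] transfer[of "{1..card A}"] by (simp add: euler_number_eq_card_words)
qed

lemma card_zigzag_up_words:
  "card {xs \<in> permutations_of_set {1..n}. zigzag False xs} = euler_number n"
proof -
  have "bij_betw (\<lambda>x. Suc n - x) {1..n} {1..n}"
    by (rule bij_betw_byWitness[where f' = "\<lambda>x. Suc n - x"]) auto
  then show ?thesis
    unfolding euler_number_eq_card_words
    by (rule card_permutations_of_set_transfer)
      (auto simp: permutations_of_set_def zigzag_map_complement)
qed

section \<open>The recurrence\<close>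

text \<open>Words glued from a decreasing prefix and a zigzag rest, with no condition on the two letters
  that meet at the junction.\<close>
definition free_words :: "nat \<Rightarrow> nat \<Rightarrow> nat list set" where
  "free_words n k = {xs \<in> permutations_of_set {1..Suc n}.
     sorted_wrt (>) (take k xs) \<and> Suc n \<notin> set (take k xs) \<and> zigzag True (drop k xs)}"

text \<open>Words that in addition ascend at the junction: the zigzag part now starts at the last
  letter of the prefix, hence \<open>k - 1\<close>, which is meant for \<open>k \<ge> 1\<close>.\<close>
definition tied_words :: "nat \<Rightarrow> nat \<Rightarrow> nat list set" where
  "tied_words n k = {xs \<in> permutations_of_set {1..Suc n}.
     sorted_wrt (>) (take k xs) \<and> Suc n \<notin> set (take k xs) \<and> zigzag False (drop (k - 1) xs)}"

text \<open>A word is determined by the letters of its prefix, a \<open>k\<close>-subset of \<open>{1..n}\<close>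
  since \<open>n + 1\<close> is excluded, together with the zigzag arrangement of the other letters.\<close>
lemma card_free_words:
  assumes "k \<le> n"
  shows "card (free_words n k) = (n choose k) * euler_number (Suc n - k)"
proof -
  define Ts where "Ts = {T. T \<subseteq> {1..n} \<and> card T = k}"
  define W where "W T = {ys \<in> permutations_of_set ({1..Suc n} - T). zigzag True ys}" for T
  have Ts: "T \<subseteq> {1..n}" "finite T" "card T = k" if "T \<in> Ts" for T
    using that by (auto simp: Ts_def intro: finite_subset)
  have "bij_betw (\<lambda>(T, ys). rev (sorted_list_of_set T) @ ys) (Sigma Ts W) (free_words n k)"
  proof (rule bij_betw_byWitness[where f' = "\<lambda>xs. (set (take k xs), drop k xs)"])
    show "\<forall>Ty\<in>Sigma Ts W. (\<lambda>xs. (set (take k xs), drop k xs))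
        ((\<lambda>(T, ys). rev (sorted_list_of_set T) @ ys) Ty) = Ty"
      using Ts by auto
    have sort_take: "rev (sorted_list_of_set (set (take k xs))) = take k xs"
      if "xs \<in> free_words n k" for xs
    proof -
      have "sorted_list_of_set (set (take k xs)) = rev (take k xs)"
        using that by (intro strict_sorted_equal)
          (auto simp: free_words_def sorted_wrt_rev)
      then show ?thesis by simp
    qed
    then show "\<forall>xs\<in>free_words n k. (\<lambda>(T, ys). rev (sorted_list_of_set T) @ ys)
        (set (take k xs), drop k xs) = xs"
      by simp
    show "(\<lambda>(T, ys). rev (sorted_list_of_set T) @ ys) ` Sigma Ts W \<subseteq> free_words n k"
    proof safe
      fix T ys assume T: "T \<in> Ts" and ys: "ys \<in> W T"
      then show "rev (sorted_list_of_set T) @ ys \<in> free_words n k"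
        using Ts[OF T]
        by (auto simp: free_words_def W_def permutations_of_set_def sorted_wrt_rev)
    qed
    show "(\<lambda>xs. (set (take k xs), drop k xs)) ` free_words n k \<subseteq> Sigma Ts W"
    proof safe
      fix xs assume xs: "xs \<in> free_words n k"
      then have perm: "set xs = {1..Suc n}" "distinct xs"
        by (auto simp: free_words_def permutations_of_set_def)
      then have len: "length xs = Suc n"
        using distinct_card[of xs] by simp
      have split: "set (take k xs) \<union> set (drop k xs) = {1..Suc n}"
          "set (take k xs) \<inter> set (drop k xs) = {}"
        using perm by (metis append_take_drop_id set_append)
          (use perm set_take_disj_set_drop_if_distinct in blast)
      have "set (take k xs) \<subseteq> {1..Suc n} - {Suc n}"
        using xs split(1) by (auto simp: free_words_def)
      then have "set (take k xs) \<subseteq> {1..n}"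
        by (simp add: subset_iff le_Suc_eq) blast
      moreover have "card (set (take k xs)) = k"
        using perm len assms by (simp add: distinct_card)
      ultimately show "set (take k xs) \<in> Ts"
        by (simp add: Ts_def)
      have "set (drop k xs) = {1..Suc n} - set (take k xs)"
        using split by blast
      then show "drop k xs \<in> W (set (take k xs))"
        using xs perm by (simp add: W_def free_words_def permutations_of_set_def)
    qed
  qed
  then have "card (free_words n k) = card (Sigma Ts W)"
    by (simp add: bij_betw_same_card)
  also have "\<dots> = (\<Sum>T\<in>Ts. card (W T))"
    by (rule card_SigmaI) (auto simp: Ts_def W_def)
  also have "\<dots> = (\<Sum>T\<in>Ts. euler_number (Suc n - k))"
  proof (rule sum.cong)
    fix T assume "T \<in> Ts"
    note T = Ts[OF this]
    have "card ({1..Suc n} - T) = Suc n - k"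
      using T by (subst card_Diff_subset) auto
    then show "card (W T) = euler_number (Suc n - k)"
      by (simp add: W_def card_zigzag_words)
  qed simp
  also have "\<dots> = (n choose k) * euler_number (Suc n - k)"
    by (simp add: Ts_def n_subsets)
  finally show ?thesis .
qed

text \<open>If the letters at the junction ascend, the word is tied at \<open>k\<close>. If they descend,
  the rest contributes its initial descent to a decreasing prefix of length \<open>k + 2\<close> that still
  avoids the largest letter, since its first letter is not the largest one; then the word is tied
  at \<open>k + 2\<close>.\<close>
lemma card_free_words_split:
  assumes "1 \<le> k" "k \<le> n"
  shows "card (free_words n k) = card (tied_words n k) + card (tied_words n (k + 2))"
proof -
  have split: "(xs \<in> free_words n k \<longleftrightarrow> xs \<in> tied_words n k \<or> xs \<in> tied_words n (k + 2)) \<and>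
      \<not> (xs \<in> tied_words n k \<and> xs \<in> tied_words n (k + 2))"
    if xs: "xs \<in> permutations_of_set {1..Suc n}" for xs
  proof -
    have set_xs: "set xs = {1..Suc n}" and dist: "distinct xs"
      using xs by (auto simp: permutations_of_set_def)
    have len: "length xs = Suc n"
      using distinct_card[OF dist] set_xs by simp
    define us where "us = take (k - 1) xs"
    have us: "length us = k - 1"
      using assms len by (simp add: us_def)
    have "length (drop (k - 1) xs) \<ge> 2"
      using assms len by simp
    then obtain x y zs where drop: "drop (k - 1) xs = x # y # zs"
      by (metis Suc_le_length_iff numeral_2_eq_2)
    have xs_eq: "xs = us @ x # y # zs"
      unfolding us_def drop[symmetric] by simp
    have takes: "take k xs = us @ [x]" "drop k xs = y # zs" "drop (k + 1) xs = zs"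
        "take (k + 2) xs = us @ x # y # take 1 zs"
      using us assms by (auto simp: xs_eq take_Cons' drop_Cons')
    have le: "x \<le> Suc n" "y \<le> Suc n" "x \<noteq> y"
      using set_xs dist unfolding xs_eq by auto
    show ?thesis
    proof (cases zs)
      \<comment> \<open>If the prefix avoids the largest letter, that letter is \<open>y\<close>: an ascent is forced.\<close>
      case Nil
      have "Suc n \<in> set xs" using set_xs by simp
      then show ?thesis
        using xs le takes drop unfolding free_words_def tied_words_def
        by (auto simp: xs_eq Nil)
    next
      case (Cons z ws)
      then show ?thesis
        using xs le takes drop unfolding free_words_def tied_words_def
        by (auto simp: sorted_wrt_append)
    qed
  qed
  have "free_words n k = tied_words n k \<union> tied_words n (k + 2)"
    "tied_words n k \<inter> tied_words n (k + 2) = {}"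
    using split by (auto simp: free_words_def tied_words_def)
  moreover have "finite (tied_words n j)" for j
    by (simp add: tied_words_def)
  ultimately show ?thesis
    by (simp add: card_Un_disjoint)
qed

lemma tied_words_empty:
  assumes "n < k"
  shows "tied_words n k = {}"
proof -
  have "take k xs = xs" if "xs \<in> permutations_of_set {1..Suc n}" for xs
    using that assms distinct_card[of xs] by (auto simp: permutations_of_set_def)
  then show ?thesis
    by (auto simp: tied_words_def permutations_of_set_def)
qed

text \<open>A word of length at least two that begins with an ascent does not begin with its largest
  letter, so for \<open>k = 1\<close> the prefix imposes no condition.\<close>
lemma card_tied_words_1:
  assumes "1 \<le> n"
  shows "card (tied_words n 1) = euler_number (Suc n)"
proof -
  have "Suc n \<notin> set (take 1 xs)"
    if xs: "xs \<in> permutations_of_set {1..Suc n}" and z: "zigzag False xs" for xs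
  proof -
    have set_xs: "set xs = {1..Suc n}" and "distinct xs"
      using xs by (auto simp: permutations_of_set_def)
    then have "length xs \<ge> 2"
      using distinct_card[of xs] assms by simp
    then obtain x y ys where xs_eq: "xs = x # y # ys"
      by (metis Suc_le_length_iff numeral_2_eq_2)
    have "y \<le> Suc n"
      using set_xs by (auto simp: xs_eq)
    then show ?thesis
      using z by (simp add: xs_eq)
  qed
  moreover have "sorted_wrt (>) (take 1 xs)" for xs :: "nat list"
    by (cases xs) auto
  ultimately have "tied_words n 1 = {xs \<in> permutations_of_set {1..Suc n}. zigzag False xs}"
    by (auto simp: tied_words_def)
  then show ?thesis
    by (simp only: card_zigzag_up_words)
qed

lemma sum_telescope_period2:
  fixes a g :: "nat \<Rightarrow> 'a::comm_ring_1"
  assumes "a 1 = 1" "a 2 = 0" "\<And>k. k \<ge> 1 \<Longrightarrow> a (k + 2) = - a k"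
  shows "(\<Sum>k = 1..n. a k * (g k + g (k + 2))) = g 1 - a (n + 1) * g (n + 1) - a (n + 2) * g (n + 2)"
proof (induction n)
  case 0
  then show ?case using assms by (simp add: numeral_2_eq_2)
next
  case (Suc n)
  have "a (Suc n + 2) = - a (Suc n)"
    by (rule assms(3)) simp
  then show ?case
    using Suc by (simp add: algebra_simps)
qed

text \<open>With \<open>k = n + 1 - r\<close> the summands are signed counts of free words. In the telescoped sum the
  boundary terms count tied words at \<open>n + 1\<close> and \<open>n + 2\<close>, and there are none.\<close>
lemma euler_number_recurrence:
  fixes a :: "nat \<Rightarrow> int"
  assumes a_odd: "\<And>n. n \<ge> 1 \<Longrightarrow> a (2 * n - 1) = (- 1) ^ (n - 1)"
    and a_even: "\<And>n. n \<ge> 1 \<Longrightarrow> a (2 * n) = 0"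
    and n: "n \<ge> 1"
  shows "int (euler_number (n + 1)) =
    (\<Sum>r = 1..n. int (n choose (r - 1)) * a (n - r + 1) * int (euler_number r))"
proof -
  have a_step: "a (k + 2) = - a k" if "k \<ge> 1" for k
  proof (cases "even k")
    case True
    then obtain m where "k = 2 * m" by blast
    then show ?thesis using a_even[of m] a_even[of "m + 1"] that by simp
  next
    case False
    then obtain m where "k = 2 * m + 1" by (rule oddE)
    then show ?thesis using a_odd[of "m + 1"] a_odd[of "m + 2"] by simp
  qed
  have "(\<Sum>r = 1..n. int (n choose (r - 1)) * a (n - r + 1) * int (euler_number r))
      = (\<Sum>k = 1..n. a k * int (card (free_words n k)))"
  proof (rule sum.reindex_bij_witness[where i = "\<lambda>k. Suc n - k" and j = "\<lambda>r. Suc n - r"])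
    fix r assume r: "r \<in> {1..n}"
    have "n choose (Suc n - r) = n choose (r - 1)"
    proof -
      have "r - 1 \<le> n" "n - (r - 1) = Suc n - r"
        using r by auto
      then show ?thesis
        using binomial_symmetric[of "r - 1" n] by simp
    qed
    then have "card (free_words n (Suc n - r)) = (n choose (r - 1)) * euler_number r"
    proof -
      have "Suc n - r \<le> n" "Suc n - (Suc n - r) = r"
        using r by auto
      with \<open>n choose (Suc n - r) = n choose (r - 1)\<close> show ?thesis
        using card_free_words[of "Suc n - r" n] by simp
    qed
    then show "a (Suc n - r) * int (card (free_words n (Suc n - r)))
        = int (n choose (r - 1)) * a (n - r + 1) * int (euler_number r)"
      using r by (simp add: Suc_diff_le)
  qed auto
  also have "\<dots> = (\<Sum>k = 1..n. a k *
      (int (card (tied_words n k)) + int (card (tied_words n (k + 2)))))"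
    by (intro sum.cong) (simp_all add: card_free_words_split)
  also have "\<dots> = int (card (tied_words n 1))"
    using a_odd[of 1] a_even[of 1] a_step
    by (subst sum_telescope_period2) (simp_all add: tied_words_empty)
  finally show ?thesis
    using card_tied_words_1[OF n] by simp
qed

section \<open>The determinant\<close>

text \<open>Since the superdiagonal entries are \<open>-1\<close>, the recurrence says that the matrix maps
  \<open>(e 1, \<dots>, e n)\<close> to the last unit vector times \<open>e (n + 1)\<close>. In a first column of this form,
  only the last entry contributes to the Laplace expansion.\<close>
lemma det_hessenberg_mat:
  fixes a e :: "nat \<Rightarrow> int"
  assumes e1: "e 1 = 1"
    and rec: "\<And>m. 1 \<le> m \<Longrightarrow> m \<le> n \<Longrightarrow> e (m + 1) = (\<Sum>r = 1..m. hessenberg_entry a m r * e r)"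
    and n: "n \<ge> 1"
  shows "det (hessenberg_mat a n) = e (n + 1)"
proof -
  define M where "M = hessenberg_mat a n"
  \<comment> \<open>Multiplication by \<open>V\<close> from the right replaces the first column of \<open>M\<close> by the
    image of \<open>(e 1, \<dots>, e n)\<close>.\<close>
  define V where "V = mat n n (\<lambda>(i, j). if j = 0 then e (i + 1) else if i = j then 1 else 0)"
  have M: "M \<in> carrier_mat n n" and V: "V \<in> carrier_mat n n"
    by (auto simp: M_def hessenberg_mat_def V_def)
  have M_entry: "M $$ (i, j) = hessenberg_entry a (i + 1) (j + 1)" if "i < n" "j < n" for i j
    using that by (simp add: M_def hessenberg_mat_def)
  have MV_entry: "(M * V) $$ (i, j) = (\<Sum>k<n. M $$ (i, k) * V $$ (k, j))"
    if "i < n" "j < n" for i j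
    using that M V by (simp add: scalar_prod_def atLeast0LessThan)
  have n_pos: "0 < n" using n by simp
  have MV_col0: "(M * V) $$ (i, 0) = (if i = n - 1 then e (n + 1) else 0)" if i: "i < n" for i
  proof -
    have "(M * V) $$ (i, 0) = (\<Sum>k<n. hessenberg_entry a (i + 1) (k + 1) * e (k + 1))"
      unfolding MV_entry[OF i n_pos]
      using i n by (intro sum.cong) (simp_all add: M_entry V_def)
    also have "\<dots> = (\<Sum>r = 1..n. hessenberg_entry a (i + 1) r * e r)"
      by (rule sum.reindex_bij_witness[where i = "\<lambda>r. r - 1" and j = Suc]) auto
    also have "\<dots> = (if i = n - 1 then e (n + 1) else 0)"
    proof (cases "i = n - 1")
      case True
      then show ?thesis using rec[of n] n by simp
    next
      case False
      then have i': "i + 2 \<le> n" using i by simp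
      have "(\<Sum>r = 1..n. hessenberg_entry a (i + 1) r * e r)
          = (\<Sum>r = 1..i + 2. hessenberg_entry a (i + 1) r * e r)"
        using i' by (intro sum.mono_neutral_right) (auto simp: hessenberg_entry_def)
      also have "\<dots> = (\<Sum>r = 1..i + 1. hessenberg_entry a (i + 1) r * e r)
          + hessenberg_entry a (i + 1) (i + 2) * e (i + 2)"
        by (simp add: numeral_2_eq_2)
      also have "\<dots> = 0"
        using rec[of "i + 1"] i' by (simp add: hessenberg_entry_def)
      finally show ?thesis using False by simp
    qed
    finally show ?thesis .
  qed
  have MV_col: "(M * V) $$ (i, j) = M $$ (i, j)" if "i < n" "j < n" "j \<noteq> 0" for i j
  proof -
    have "(M * V) $$ (i, j) = (\<Sum>k<n. if k = j then M $$ (i, k) else 0)"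
      unfolding MV_entry[OF that(1,2)] using that by (intro sum.cong) (simp_all add: V_def)
    then show ?thesis using that by simp
  qed
  have "det V = (\<Prod>i = 0..<n. V $$ (i, i))"
    using V by (subst det_lower_triangular[OF _ V]) (auto simp: V_def prod_list_diag_prod)
  also have "\<dots> = 1"
    using e1 by (intro prod.neutral) (auto simp: V_def)
  finally have "det (M * V) = det M"
    by (simp add: det_mult[OF M V])
  moreover have "det (M * V) = e (n + 1)"
  proof -
    \<comment> \<open>In the minor, the superdiagonal of \<open>M\<close> has become the diagonal.\<close>
    define D where "D = mat_delete (M * V) (n - 1) 0"
    have D: "D \<in> carrier_mat (n - 1) (n - 1)"
      unfolding D_def using M V by (intro mat_delete_carrier) auto
    have D_entry: "D $$ (i, j) = hessenberg_entry a (i + 1) (j + 2)"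
      if "i < n - 1" "j < n - 1" for i j
      using that M V by (simp add: D_def mat_delete_def MV_col M_entry del: index_mult_mat(1))
    have "det D = (\<Prod>i = 0..<n - 1. D $$ (i, i))"
      using D by (subst det_lower_triangular[OF _ D])
        (auto simp: D_entry hessenberg_entry_def prod_list_diag_prod)
    also have "\<dots> = (- 1) ^ (n - 1)"
      by (simp add: D_entry hessenberg_entry_def)
    finally have cof: "cofactor (M * V) (n - 1) 0 = 1"
      by (simp add: cofactor_def D_def flip: power_mult_distrib)
    have "det (M * V) = (\<Sum>i<n. (M * V) $$ (i, 0) * cofactor (M * V) i 0)"
      using M V n by (intro laplace_expansion_column) auto
    also have "\<dots> = (\<Sum>i<n. if i = n - 1 then e (n + 1) * cofactor (M * V) i 0 else 0)"
      by (intro sum.cong) (simp_all add: MV_col0 del: index_mult_mat(1))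
    also have "\<dots> = e (n + 1)"
      using n cof by simp
    finally show ?thesis .
  qed
  ultimately show ?thesis by (simp add: M_def)
qed

theorem corollary9:
  fixes a :: "nat \<Rightarrow> int"
  assumes "\<And>n. n \<ge> 1 \<Longrightarrow> a (2 * n - 1) = (- 1) ^ (n - 1)"
    and "\<And>n. n \<ge> 1 \<Longrightarrow> a (2 * n) = 0"
  shows "(\<forall>n\<ge>1. int (euler_number (n + 1)) = det (hessenberg_mat a n)) \<and>
    (\<forall>n\<ge>1. int (euler_number (n + 1)) =
       (\<Sum>r = 1..n. int (n choose (r - 1)) * a (n - r + 1) * int (euler_number r))) \<and>
    euler_number 1 = 1 \<and> euler_number 2 = 1 \<and> euler_number 3 = 2"
proof -
  have rec: "int (euler_number (n + 1)) =
      (\<Sum>r = 1..n. int (n choose (r - 1)) * a (n - r + 1) * int (euler_number r))"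
    if "n \<ge> 1" for n
    using assms that by (rule euler_number_recurrence)
  have E1: "euler_number 1 = 1"
  proof -
    have "{xs \<in> permutations_of_set {1..1::nat}. zigzag True xs} = {[1]}"
      by auto
    then show ?thesis
      by (simp add: euler_number_eq_card_words)
  qed
  have E2: "euler_number 2 = 1"
    using rec[of 1] assms(1)[of 1] E1 by (simp add: numeral_2_eq_2)
  have "int (euler_number 3) = 2"
    using rec[of 2] assms(1)[of 1] assms(2)[of 1] E1 E2
    by (simp add: numeral_2_eq_2 numeral_3_eq_3)
  then have E3: "euler_number 3 = 2"
    by simp
  have "int (euler_number (n + 1)) = det (hessenberg_mat a n)" if n: "n \<ge> 1" for n
  proof (rule det_hessenberg_mat[symmetric])
    fix m :: nat assume m: "1 \<le> m" "m \<le> n"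
    show "int (euler_number (m + 1)) = (\<Sum>r = 1..m. hessenberg_entry a m r * int (euler_number r))"
      unfolding rec[OF m(1)] by (intro sum.cong) (simp_all add: hessenberg_entry_def)
  qed (use E1 n in simp_all)
  then show ?thesis
    using rec E1 E2 E3 by blast
qed

end
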